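(* For every integer $r\ge 2$ there exists a constant $c_r$ (depending only on $r$) such that for all integers $\ell\ge 1$ and all $m\ge 1$, $$\mathrm{forb}(m,r,\mathcal{T}_{\ell}(r))\le 2^{c_r\ell^2}.$$ In particular, for $r=2$, for all $\ell\ge 1$ and $m\ge 1$, $$\mathrm{forb}(m,2,\{I_\ell,I_\ell^c,T_\ell\})\le 2^{c_2(\ell^2+\ell)}$$ with the constant $c_2\le 6\log_2 6<15.51$.
   Context: An $r$-matrix is a matrix all of whose entries lie in $\{0,1,\ldots,r-1\}$. A matrix is simple if it has no repeated columns. For matrices $F,A$, write $F\prec A$ ($F$ is a configuration in $A$) if some row and column permutation of $F$ is a submatrix of $A$. $\|A\|$ is the number of columns of $A$. For a family $\mathcal{F}$ of matrices, $\mathrm{forb}(m,r,\mathcal{F})$ is the maximum of $\|A\|$ over all $m$-rowed simple $r$-matrices $A$ such that $F\nprec A$ for every $F\in\mathcal{F}$. For $a\ne b$, $I_\ell(a,b)$ is the $\ell\times\ell$ matrix with $a$'s on the diagonal and $b$'s elsewhere; $T_\ell(a,b)$ is the $\ell\times\ell$ matrix with $a$'s (strictly) below the diagonal and $b$'s elsewhere. Set $$\mathcal{T}_\ell(r)=\{I_\ell(a,b): a,b\in\{0,\ldots,r-1\},a\neq b\}\cup\{T_\ell(a,b): a,b\in\{0,\ldots,r-1\},a\neq b\}.$$ $I_\ell$ is the $\ell\times\ell$ identity matrix, $I_\ell^c$ its $(0,1)$-complement, and $T_\ell$ the $\ell\times\ell$ $(0,1)$-matrix with a $1$ in position $(i,j)$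 if and only if $i\le j$. *)

theory Defs
  imports
    Complex_Main
    "HOL-Combinatorics.Permutations"
    "Jordan_Normal_Form.DL_Submatrix"
begin

definition r_matrix :: "nat \<Rightarrow> nat mat \<Rightarrow> bool" where
  "r_matrix r A \<longleftrightarrow> elements_mat A \<subseteq> {..<r}"

definition simple_matrix :: "nat mat \<Rightarrow> bool" where
  "simple_matrix A \<longleftrightarrow> distinct (cols A)"

definition permute_rows_cols :: "(nat \<Rightarrow> nat) \<Rightarrow> (nat \<Rightarrow> nat) \<Rightarrow> 'a mat \<Rightarrow> 'a mat" where
  "permute_rows_cols p q F = mat (dim_row F) (dim_col F) (\<lambda>(i, j). F $$ (p i, q j))"

definition configuration :: "'a mat \<Rightarrow> 'a mat \<Rightarrow> bool" (infix \<open>\<prec>\<close> 50) where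
  "F \<prec> A \<longleftrightarrow> (\<exists>p q I J. p permutes {..<dim_row F} \<and> q permutes {..<dim_col F} \<and>
      permute_rows_cols p q F = submatrix A I J)"

definition avoiding :: "nat \<Rightarrow> nat \<Rightarrow> nat mat set \<Rightarrow> nat mat set" where
  "avoiding m r \<F> =
    {A. dim_row A = m \<and> r_matrix r A \<and> simple_matrix A \<and> (\<forall>F\<in>\<F>. \<not> F \<prec> A)}"

text \<open>
  Matrices without columns are admitted. Hence the set below is nonempty whenever no member of
  the family is columnless; it is always finite, so \<^const>\<open>Max\<close> is a genuine maximum
  (see \<open>finite_avoiding\<close> and \<open>avoiding_nonempty\<close>).
\<close>

definition forb :: "nat \<Rightarrow> nat \<Rightarrow> nat mat set \<Rightarrow> nat" where
  "forb m r \<F> = Max (dim_col ` avoiding m r \<F>)"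

definition I_mat :: "nat \<Rightarrow> nat \<Rightarrow> nat \<Rightarrow> nat mat" where
  "I_mat l a b = mat l l (\<lambda>(i, j). if i = j then a else b)"

definition T_mat :: "nat \<Rightarrow> nat \<Rightarrow> nat \<Rightarrow> nat mat" where
  "T_mat l a b = mat l l (\<lambda>(i, j). if j < i then a else b)"

definition T_family :: "nat \<Rightarrow> nat \<Rightarrow> nat mat set" where
  "T_family l r =
    {I_mat l a b | a b. a \<in> {..<r} \<and> b \<in> {..<r} \<and> a \<noteq> b} \<union>
    {T_mat l a b | a b. a \<in> {..<r} \<and> b \<in> {..<r} \<and> a \<noteq> b}"

definition complement01 :: "nat mat \<Rightarrow> nat mat" where
  "complement01 A = map_mat (\<lambda>x. 1 - x) A"

definition upper_T :: "nat \<Rightarrow> nat mat" where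
  "upper_T l = mat l l (\<lambda>(i, j). if i \<le> j then 1 else 0)"

lemma finite_avoiding: "finite (dim_col ` avoiding m r \<F>)"
proof -
  let ?S = "vec_of_list ` {xs. set xs \<subseteq> {..<r} \<and> length xs = m}"
  have fin: "finite ?S"
    by (intro finite_imageI finite_lists_length_eq) simp
  have "dim_col A \<le> card ?S" if A: "A \<in> avoiding m r \<F>" for A
  proof -
    have dr: "dim_row A = m" and el: "elements_mat A \<subseteq> {..<r}"
      using A by (simp_all add: avoiding_def r_matrix_def)
    have sub: "set (cols A) \<subseteq> ?S"
    proof
      fix v assume "v \<in> set (cols A)"
      then obtain j where j: "j < dim_col A" "v = col A j"
        by (auto simp: cols_def)
      have lt: "v $ i < r" if "i < m" for i
      proof -
        have "A $$ (i, j) \<in> elements_mat A"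
          by (rule elements_matI[of A m "dim_col A" i j]) (use that j dr in auto)
        then show ?thesis
          using el that j dr by (simp add: subset_iff)
      qed
      have dv: "dim_vec v = m"
        using j dr by simp
      have "set (list_of_vec v) \<subseteq> {..<r}"
      proof
        fix x assume "x \<in> set (list_of_vec v)"
        then obtain i where "i < dim_vec v" "x = v $ i"
          by (metis in_set_conv_nth length_list_of_vec list_of_vec_index)
        then show "x \<in> {..<r}"
          using lt dv by simp
      qed
      moreover have "length (list_of_vec v) = m"
        using dv by simp
      ultimately have "list_of_vec v \<in> {xs. set xs \<subseteq> {..<r} \<and> length xs = m}"
        by simp
      then have "vec_of_list (list_of_vec v) \<in> ?S"
        by (rule imageI)
      then show "v \<in> ?S"
        by (simp only: vec_list)
    qed
    have "dim_col A = card (set (cols A))"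
      using A by (simp add: avoiding_def simple_matrix_def distinct_card)
    also have "\<dots> \<le> card ?S"
      by (rule card_mono[OF fin sub])
    finally show ?thesis .
  qed
  then have "dim_col ` avoiding m r \<F> \<subseteq> {..card ?S}"
    by auto
  then show ?thesis
    by (rule finite_subset) simp
qed

lemma avoiding_nonempty:
  assumes "\<And>F. F \<in> \<F> \<Longrightarrow> dim_col F > 0"
  shows "avoiding m r \<F> \<noteq> {}"
proof -
  have "\<not> F \<prec> (mat m 0 f :: nat mat)" if "F \<in> \<F>" for F f
  proof
    assume "F \<prec> mat m 0 f"
    then obtain p q I J where "permute_rows_cols p q F = submatrix (mat m 0 f) I J"
      by (auto simp: configuration_def)
    then have "dim_col (permute_rows_cols p q F) = dim_col (submatrix (mat m 0 f) I J)"
      by simp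
    then show False
      using assms[OF that] by (simp add: permute_rows_cols_def dim_submatrix)
  qed
  then have "mat m 0 (\<lambda>_. 0) \<in> avoiding m r \<F>"
    by (auto simp: avoiding_def r_matrix_def simple_matrix_def elements_mat_def cols_def)
  then show ?thesis by blast
qed

end

theory Submission
  imports Defs
begin

text \<open>
  Let \<open>A\<close> be a simple \<open>r\<close>-matrix. Choose a set \<open>M\<close> of rows that still tells all columns apart
  and is as small as possible. By minimality every row \<open>i\<close> of \<open>M\<close> is critical: some two columns
  \<open>x\<^sub>i\<close>, \<open>y\<^sub>i\<close> differ in row \<open>i\<close> and in no other row of \<open>M\<close> (\<open>critical_rows\<close>). The bound follows
  from two facts.

  If \<open>M\<close> is large, namely exponential in \<open>l\<close>, then \<open>A\<close> contains a forbidden configuration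
  (\<open>many_critical_rows\<close>). Colour an ordered pair \<open>(i, j)\<close> of rows with the two entries of column
  \<open>x\<^sub>i\<close> in row \<open>j\<close> and of column \<open>x\<^sub>j\<close> in row \<open>i\<close>. On a homogeneous set of rows the columns \<open>x\<^sub>i\<close>
  form a square matrix with a constant \<open>p\<close> below the diagonal and a constant \<open>q\<close> above it. The
  columns \<open>y\<^sub>i\<close> have the same entries off the diagonal and another value on it. If \<open>p = q\<close>, one of
  the two diagonal values differs from \<open>p\<close>, and the matrix is of type \<open>I\<close>. If \<open>p \<noteq> q\<close>, taking rows
  of even index and columns of odd index avoids the diagonal, and the matrix is of type \<open>T\<close>.

  If \<open>M\<close> is small, a theorem of Sauer and Shelah in the version of Natarajan for more than two
  values applies: a family of more than \<open>(q |M| + 1)\<^sup>d\<close> functions on \<open>M\<close>, where now \<open>q\<close> is the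
  number of pairs of values, shatters \<open>d\<close> rows, each with respect to some two values
  (\<open>shattering_bound\<close>). With \<open>d = q l\<close>, some \<open>l\<close> of these rows are shattered with respect to the
  same two values, which yields a configuration of type \<open>I\<close>.

  So the number of columns is at most a power of \<open>|M|\<close> with exponent linear in \<open>l\<close>, where \<open>|M|\<close> is
  at most exponential in \<open>l\<close>. This is the order \<open>2\<close> to the power \<open>c l\<^sup>2\<close>.

  For \<open>r = 2\<close> there is a single pair of values, so \<open>q = 1\<close>, and the diagonal can always be chosen
  freely from both values. Hence homogeneous sets of size \<open>l\<close> suffice, and four colours give
  \<open>|M| < 2\<close> to the power \<open>8 l\<close>. The resulting constant is \<open>8\<close>, which lies below \<open>6 log\<^sub>2 6\<close>.
  The three matrices \<open>I\<^sub>l\<close>, its complement and \<open>T\<^sub>l\<close> belong to the family \<open>\<T>\<^sub>l(2)\<close>, so this bound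
  serves both parts of the theorem.
\<close>

section \<open>Pigeonhole and Ramsey arguments\<close>

text \<open>
  The hypothesis says that \<open>n\<close> is at most the ceiling of the average fibre size. This rounding is
  what lets a single vertex be removed at no cost in the Ramsey argument below.
\<close>

lemma large_fibre:
  assumes "finite B" "finite P" "f ` B \<subseteq> P" "card P * n < card B + card P"
  shows "\<exists>p\<in>P. n \<le> card {x \<in> B. f x = p}"
proof (rule ccontr)
  assume "\<not> ?thesis"
  then have less: "card {x \<in> B. f x = p} + 1 \<le> n" if "p \<in> P" for p
    using that by force
  have "B = (\<Union>p\<in>P. {x \<in> B. f x = p})"
    using assms(3) by blast
  then have "card B \<le> (\<Sum>p\<in>P. card {x \<in> B. f x = p})"
    using card_UN_le[OF assms(2), of "\<lambda>p. {x \<in> B. f x = p}"] by simp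
  then have "card B + card P \<le> (\<Sum>p\<in>P. card {x \<in> B. f x = p} + 1)"
    by (simp only: sum.distrib) simp
  also have "\<dots> \<le> (\<Sum>p\<in>P. n)"
    using less by (intro sum_mono)
  finally show False
    using assms(4) by simp
qed

text \<open>
  The usual greedy argument: pick a vertex, keep only the largest class of its out-neighbours by
  colour, and continue there. Each vertex on the list is paired with the colour that it sends to
  all later ones. The colouring need not be symmetric, since only pairs in list order matter.
\<close>

lemma ramsey_end_coloured:
  fixes \<chi> :: "'a \<Rightarrow> 'a \<Rightarrow> 'c"
  assumes "finite C" "card C \<ge> 2"
    and "finite V" "card C ^ n \<le> card V"
    and "\<And>v w. v \<in> V \<Longrightarrow> w \<in> V \<Longrightarrow> v \<noteq> w \<Longrightarrow> \<chi> v w \<in> C"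
  shows "\<exists>ps. length ps = n \<and> fst ` set ps \<subseteq> V \<and> distinct (map fst ps) \<and> snd ` set ps \<subseteq> C \<and>
    sorted_wrt (\<lambda>x y. \<chi> (fst x) (fst y) = snd x) ps"
  using assms(3-)
proof (induction n arbitrary: V)
  case 0
  show ?case by (intro exI[of _ "[]"]) simp
next
  case (Suc n)
  have "V \<noteq> {}"
    using Suc.prems(2) assms(2) by (auto simp: not_le)
  then obtain v where v: "v \<in> V" by blast
  let ?W = "V - {v}"
  have "card V = card ?W + 1"
    using v Suc.prems(1) by (metis Suc_eq_plus1 card_Suc_Diff1)
  then have "card C * card C ^ n < card ?W + card C"
    using Suc.prems(2) assms(2) by simp
  then have "\<exists>c\<in>C. card C ^ n \<le> card {w \<in> ?W. \<chi> v w = c}"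
    by (intro large_fibre) (use Suc.prems v assms(1) in auto)
  then obtain c where c: "c \<in> C" "card C ^ n \<le> card {w \<in> ?W. \<chi> v w = c}"
    by blast
  obtain ps where ps: "length ps = n" "fst ` set ps \<subseteq> {w \<in> ?W. \<chi> v w = c}"
      "distinct (map fst ps)" "snd ` set ps \<subseteq> C"
      "sorted_wrt (\<lambda>x y. \<chi> (fst x) (fst y) = snd x) ps"
    using Suc.IH[of "{w \<in> ?W. \<chi> v w = c}"] Suc.prems c(2) by auto
  show ?case
    by (rule exI[of _ "(v, c) # ps"]) (use ps c v in auto)
qed

lemma ramsey_ordered:
  fixes \<chi> :: "'a \<Rightarrow> 'a \<Rightarrow> 'c"
  assumes "finite C" "card C \<ge> 2" "finite V" "card C ^ (card C * n) \<le> card V"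
    and "\<And>v w. v \<in> V \<Longrightarrow> w \<in> V \<Longrightarrow> v \<noteq> w \<Longrightarrow> \<chi> v w \<in> C"
  shows "\<exists>c\<in>C. \<exists>xs. length xs = n \<and> set xs \<subseteq> V \<and> distinct xs \<and>
    sorted_wrt (\<lambda>x y. \<chi> x y = c) xs"
proof -
  obtain ps where ps: "length ps = card C * n" "fst ` set ps \<subseteq> V"
      "distinct (map fst ps)" "snd ` set ps \<subseteq> C"
      "sorted_wrt (\<lambda>x y. \<chi> (fst x) (fst y) = snd x) ps"
    using ramsey_end_coloured[where \<chi> = \<chi>, OF assms] by blast
  have "\<exists>c\<in>C. n \<le> card {s \<in> {..<length ps}. snd (ps ! s) = c}"
    by (rule large_fibre) (use ps(1,4) assms(1,2) in auto)
  then obtain c where c: "c \<in> C" "n \<le> length (filter (\<lambda>x. snd x = c) ps)"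
    by (auto simp: length_filter_conv_card)
  define qs where "qs = filter (\<lambda>x. snd x = c) ps"
  have "sorted_wrt (\<lambda>x y. \<chi> (fst x) (fst y) = snd x) qs"
    unfolding qs_def by (rule sorted_wrt_filter[OF ps(5)])
  then have "sorted_wrt (\<lambda>x y. \<chi> (fst x) (fst y) = c) qs"
    by (rule sorted_wrt_mono_rel[rotated]) (auto simp: qs_def)
  then have "sorted_wrt (\<lambda>x y. \<chi> x y = c) (take n (map fst qs))"
    by (intro sorted_wrt_take) (simp add: sorted_wrt_map)
  moreover have "distinct (map fst qs)"
    unfolding qs_def by (rule distinct_map_filter[OF ps(3)])
  moreover have "set (take n (map fst qs)) \<subseteq> V"
    using ps(2) set_take_subset[of n "map fst qs"] by (fastforce simp: qs_def)
  ultimately show ?thesis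
    using c by (intro bexI[of _ c] exI[of _ "take n (map fst qs)"]) (auto simp: qs_def)
qed

section \<open>Critical rows\<close>

text \<open>
  Counting unordered pairs of values, written in increasing order, matters for the constant:
  for \<open>r = 2\<close> there is exactly one.
\<close>

abbreviation increasing_pairs :: "nat \<Rightarrow> (nat \<times> nat) set" where
  "increasing_pairs r \<equiv> {(a, b). a < b \<and> b < r}"

lemma finite_increasing_pairs: "finite (increasing_pairs r)"
  by (rule finite_subset[of _ "{..<r} \<times> {..<r}"]) auto

lemma card_increasing_pairs_pos: "r \<ge> 2 \<Longrightarrow> card (increasing_pairs r) > 0"
  using finite_increasing_pairs[of r] by (force simp: card_gt_0_iff intro: exI[of _ 0] exI[of _ 1])

lemma critical_rows:
  fixes e :: "'i \<Rightarrow> 'j \<Rightarrow> 'v"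
  assumes "finite R"
    and "inj_on (\<lambda>j. restrict (\<lambda>i. e i j) R) J"
  obtains M where "M \<subseteq> R" "inj_on (\<lambda>j. restrict (\<lambda>i. e i j) M) J"
    "\<And>i. i \<in> M \<Longrightarrow> \<exists>j\<in>J. \<exists>j'\<in>J. e i j \<noteq> e i j' \<and> (\<forall>i'\<in>M - {i}. e i' j = e i' j')"
proof -
  let ?sep = "\<lambda>M. inj_on (\<lambda>j. restrict (\<lambda>i. e i j) M) J"
  obtain M where M: "M \<subseteq> R" "?sep M"
      and min: "\<And>M'. M' \<subseteq> R \<Longrightarrow> ?sep M' \<Longrightarrow> card M \<le> card M'"
    using ex_has_least_nat[of "\<lambda>M. M \<subseteq> R \<and> ?sep M" R card] assms by blast
  have "\<exists>j\<in>J. \<exists>j'\<in>J. e i j \<noteq> e i j' \<and> (\<forall>i'\<in>M - {i}. e i' j = e i' j')" if i: "i \<in> M" for i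
  proof -
    have "card (M - {i}) < card M"
      using i M(1) assms(1) by (meson card_Diff1_less finite_subset)
    then have "\<not> ?sep (M - {i})"
      using min[of "M - {i}"] M(1) by auto
    then obtain j j' where j: "j \<in> J" "j' \<in> J" "j \<noteq> j'"
        "restrict (\<lambda>i'. e i' j) (M - {i}) = restrict (\<lambda>i'. e i' j') (M - {i})"
      by (auto simp: inj_on_def)
    have agree: "\<forall>i'\<in>M - {i}. e i' j = e i' j'"
      using j(4) by (metis restrict_apply')
    have "e i j \<noteq> e i j'"
    proof
      assume "e i j = e i j'"
      then have "restrict (\<lambda>i'. e i' j) M = restrict (\<lambda>i'. e i' j') M"
        using agree by (auto simp: restrict_def fun_eq_iff)
      then show False
        using M(2) j(1-3) by (auto simp: inj_on_def)
    qed
    then show ?thesis using agree j by blast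
  qed
  then show thesis using that M by blast
qed

text \<open>
  In the conclusion \<open>a\<close> and \<open>b\<close> are the values of \<open>x\<^sub>i\<close> and \<open>y\<^sub>i\<close> in their own row \<open>i\<close>. Choosing
  the column \<open>x\<^sub>i\<close> or \<open>y\<^sub>i\<close> therefore prescribes the diagonal, while the entries off the diagonal
  are the same for both choices.
\<close>

lemma many_critical_rows:
  fixes e :: "'i \<Rightarrow> 'j \<Rightarrow> nat"
  assumes "r \<ge> 2" "finite M"
    and range: "\<And>i j. i \<in> M \<Longrightarrow> j \<in> J \<Longrightarrow> e i j < r"
    and critical: "\<And>i. i \<in> M \<Longrightarrow>
      \<exists>j\<in>J. \<exists>j'\<in>J. e i j \<noteq> e i j' \<and> (\<forall>i'\<in>M - {i}. e i' j = e i' j')"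
    and large: "card (increasing_pairs r) * (r * r) ^ (r * r * K) \<le> card M"
  obtains p q a b \<rho> where "p < r" "q < r" "a < b" "b < r" "inj_on \<rho> {..<K}" "\<rho> ` {..<K} \<subseteq> M"
    "\<forall>d\<in>{a, b}. \<exists>\<kappa>. \<kappa> ` {..<K} \<subseteq> J \<and>
      (\<forall>s<K. \<forall>t<K. e (\<rho> s) (\<kappa> t) = (if t < s then p else if s < t then q else d))"
proof -
  have "\<exists>x y. x \<in> J \<and> y \<in> J \<and> e i x < e i y \<and> (\<forall>i'\<in>M - {i}. e i' x = e i' y)"
    if i: "i \<in> M" for i
    using critical[OF i] by (metis linorder_neqE_nat)
  then obtain x y where xy: "\<And>i. i \<in> M \<Longrightarrow> x i \<in> J" "\<And>i. i \<in> M \<Longrightarrow> y i \<in> J"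
      "\<And>i. i \<in> M \<Longrightarrow> e i (x i) < e i (y i)"
      "\<And>i i'. i \<in> M \<Longrightarrow> i' \<in> M \<Longrightarrow> i' \<noteq> i \<Longrightarrow> e i' (x i) = e i' (y i)"
    by (metis Diff_iff singletonD)
  \<comment> \<open>The first factor of the bound on \<open>M\<close> pays for equal diagonal pairs, the power for Ramsey.\<close>
  have "\<exists>ab\<in>increasing_pairs r. (r * r) ^ (r * r * K) \<le> card {i \<in> M. (e i (x i), e i (y i)) = ab}"
    by (rule large_fibre[OF assms(2) finite_increasing_pairs])
      (use xy range large card_increasing_pairs_pos[OF assms(1)] in auto)
  then obtain a b where ab: "(a, b) \<in> increasing_pairs r"
      "(r * r) ^ (r * r * K) \<le> card {i \<in> M. (e i (x i), e i (y i)) = (a, b)}"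
    by auto
  define V where "V = {i \<in> M. (e i (x i), e i (y i)) = (a, b)}"
  have rr: "2 \<le> r * r"
    using mult_le_mono[of 2 r 1 r] assms(1) by simp
  let ?\<chi> = "\<lambda>i j. (e j (x i), e i (x j))"
  have "\<exists>c\<in>{..<r} \<times> {..<r}. \<exists>xs. length xs = K \<and> set xs \<subseteq> V \<and> distinct xs \<and>
      sorted_wrt (\<lambda>i j. ?\<chi> i j = c) xs"
    by (rule ramsey_ordered)
      (use rr assms(2) ab(2) range xy(1) in \<open>auto simp: V_def card_cartesian_product\<close>)
  then obtain p q xs where pq: "p < r" "q < r" and xs: "length xs = K" "set xs \<subseteq> V" "distinct xs"
      "sorted_wrt (\<lambda>i j. ?\<chi> i j = (p, q)) xs"
    by auto
  have mem: "xs ! s \<in> M" "e (xs ! s) (x (xs ! s)) = a" "e (xs ! s) (y (xs ! s)) = b"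
    if "s < K" for s
  proof -
    have "xs ! s \<in> V"
      using xs(1,2) that by force
    then show "xs ! s \<in> M" "e (xs ! s) (x (xs ! s)) = a" "e (xs ! s) (y (xs ! s)) = b"
      by (auto simp: V_def)
  qed
  have below: "e (xs ! s) (x (xs ! t)) = p" if "t < s" "s < K" for s t
    using sorted_wrt_nth_less[OF xs(4) that(1)] that xs(1) by simp
  have above: "e (xs ! s) (x (xs ! t)) = q" if "s < t" "t < K" for s t
    using sorted_wrt_nth_less[OF xs(4) that(1)] that xs(1) by simp
  have neq: "xs ! s \<noteq> xs ! t" if "s \<noteq> t" "s < K" "t < K" for s t
    using xs(1,3) that by (simp add: nth_eq_iff_index_eq)
  have "\<exists>\<kappa>. \<kappa> ` {..<K} \<subseteq> J \<and>
      (\<forall>s<K. \<forall>t<K. e (xs ! s) (\<kappa> t) = (if t < s then p else if s < t then q else d))"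
    if d: "d \<in> {a, b}" for d
  proof (cases "d = a")
    case True
    show ?thesis
      by (rule exI[of _ "\<lambda>t. x (xs ! t)"])
        (use True mem below above xy(1) in \<open>auto simp: not_less_iff_gr_or_eq\<close>)
  next
    case False
    have "e (xs ! s) (y (xs ! t)) = e (xs ! s) (x (xs ! t))" if "s \<noteq> t" "s < K" "t < K" for s t
      using xy(4)[OF mem(1)[OF that(3)] mem(1)[OF that(2)]] neq[OF that] by simp
    then have "e (xs ! s) (y (xs ! t)) = (if t < s then p else if s < t then q else d)"
      if "s < K" "t < K" for s t
      using that mem[of s] below[of t s] above[of s t] False d
      by (cases s t rule: linorder_cases) auto
    then show ?thesis
      by (intro exI[of _ "\<lambda>t. y (xs ! t)"]) (use mem(1) xy(2) in auto)
  qed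
  moreover have "inj_on (\<lambda>s. xs ! s) {..<K}"
    using neq by (auto simp: inj_on_def)
  moreover have "(\<lambda>s. xs ! s) ` {..<K} \<subseteq> M"
    using mem by auto
  moreover have "a < b" "b < r"
    using ab(1) by auto
  ultimately show thesis
    using that[of p q a b "\<lambda>s. xs ! s"] pq by blast
qed

section \<open>Shattered rows\<close>

text \<open>
  Induction on \<open>M\<close>, removing a row \<open>i\<close>. A function in \<open>S\<close> is minimal if its value at \<open>i\<close> cannot be
  lowered within \<open>S\<close>. Minimal functions are determined by their restrictions to \<open>M\<close>. A function that
  is not minimal has a restriction which extends into \<open>S\<close> by both of two values \<open>a < b\<close> at \<open>i\<close>. If
  there are many minimal functions, the restrictions to \<open>M\<close> shatter \<open>d\<close> rows. Otherwise many
  restrictions belong to one pair \<open>(a, b)\<close>; they shatter \<open>d - 1\<close> rows, and \<open>i\<close> can be added to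
  these with the pair \<open>(a, b)\<close>. The counts combine through
  \<open>X\<^sup>d + q X\<^sup>d\<^sup>-\<^sup>1 \<le> (X + q)\<^sup>d\<close>.
\<close>

lemma shattering_bound:
  fixes S :: "('i \<Rightarrow> nat) set"
  assumes "finite M" "S \<subseteq> M \<rightarrow>\<^sub>E {..<r}" "(card (increasing_pairs r) * card M + 1) ^ d < card S"
  shows "\<exists>B \<pi>. B \<subseteq> M \<and> card B = d \<and> \<pi> ` B \<subseteq> increasing_pairs r \<and>
    (\<forall>X\<subseteq>B. \<exists>h\<in>S. \<forall>i\<in>B. h i = (if i \<in> X then snd (\<pi> i) else fst (\<pi> i)))"
  using assms
proof (induction M arbitrary: S d rule: finite_induct)
  case empty
  then have "S \<subseteq> {\<lambda>_. undefined}"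
    by auto
  then have "card S \<le> card {\<lambda>_ :: 'i. undefined :: nat}"
    by (rule card_mono[rotated]) simp
  then show ?case
    using empty.prems by simp
next
  case (insert i M)
  show ?case
  proof (cases d)
    case 0
    then have "S \<noteq> {}"
      using insert.prems(2) by auto
    then show ?thesis
      using 0 by (intro exI[of _ "{}"]) auto
  next
    case (Suc d')
    let ?\<rho> = "\<lambda>h. restrict h M"
    let ?Q = "increasing_pairs r"
    define X where "X = card ?Q * card M + 1"
    define S1 where "S1 = {h \<in> S. \<forall>a < h i. h(i := a) \<notin> S}"
    define D where "D = (\<lambda>(a, b). {g \<in> ?\<rho> ` S. g(i := a) \<in> S \<and> g(i := b) \<in> S})"
    have finS: "finite S"
      using insert.prems(1) insert.hyps(1) by (meson finite_PiE finite.insertI finite_lessThan finite_subset)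
    have glue: "h = (?\<rho> h)(i := h i)" if "h \<in> S" for h
      using insert.prems(1) that insert.hyps(2) by (auto simp: fun_eq_iff PiE_iff extensional_def)
    have shift: "(?\<rho> h)(i := a) = h(i := a)" if "h \<in> S" for h a
      using insert.prems(1) that insert.hyps(2) by (auto simp: fun_eq_iff PiE_iff extensional_def)
    have \<rho>S: "?\<rho> ` S \<subseteq> M \<rightarrow>\<^sub>E {..<r}"
      using insert.prems(1) by (auto simp: PiE_iff Pi_iff)
    have inj: "inj_on ?\<rho> S1"
    proof (rule inj_onI)
      fix h h' assume hh: "h \<in> S1" "h' \<in> S1" "?\<rho> h = ?\<rho> h'"
      then have hS: "h \<in> S" "h' \<in> S"
        by (auto simp: S1_def)
      have "h(i := h' i) = h'" "h'(i := h i) = h"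
        using shift[OF hS(1)] shift[OF hS(2)] glue hS hh(3) by metis+
      then have "\<not> h i < h' i" "\<not> h' i < h i"
        using hh(1,2) hS unfolding S1_def by auto
      then show "h = h'"
        using \<open>h(i := h' i) = h'\<close> by (metis fun_upd_triv linorder_neqE_nat)
    qed
    have cover: "S \<subseteq> S1 \<union> (\<Union>ab\<in>?Q. (\<lambda>g. g(i := snd ab)) ` D ab)"
    proof
      fix h assume h: "h \<in> S"
      show "h \<in> S1 \<union> (\<Union>ab\<in>?Q. (\<lambda>g. g(i := snd ab)) ` D ab)"
      proof (cases "h \<in> S1")
        case False
        then obtain a where a: "a < h i" "h(i := a) \<in> S"
          using h by (auto simp: S1_def)
        have "h i < r"
          using h insert.prems(1) by (auto simp: PiE_iff)
        then have Q: "(a, h i) \<in> ?Q"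
          using a(1) by simp
        have "?\<rho> h \<in> D (a, h i)"
          using h a(2) shift[OF h] by (auto simp: D_def)
        then have "h \<in> (\<lambda>g. g(i := snd (a, h i))) ` D (a, h i)"
          using glue[OF h] by force
        then show ?thesis
          using Q by blast
      qed simp
    qed
    have "\<not> (card S1 \<le> X ^ d \<and> (\<forall>ab\<in>?Q. card (D ab) \<le> X ^ d'))"
    proof
      assume small: "card S1 \<le> X ^ d \<and> (\<forall>ab\<in>?Q. card (D ab) \<le> X ^ d')"
      have finD: "finite (D ab)" for ab
        using finS by (cases ab) (simp add: D_def)
      have fin: "finite (S1 \<union> (\<Union>ab\<in>?Q. (\<lambda>g. g(i := snd ab)) ` D ab))"
        using finS finite_increasing_pairs finD by (auto simp: S1_def)
      have "card S \<le> card S1 + card (\<Union>ab\<in>?Q. (\<lambda>g. g(i := snd ab)) ` D ab)"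
        using card_mono[OF fin cover] card_Un_le le_trans by blast
      also have "card (\<Union>ab\<in>?Q. (\<lambda>g. g(i := snd ab)) ` D ab) \<le> (\<Sum>ab\<in>?Q. card ((\<lambda>g. g(i := snd ab)) ` D ab))"
        by (rule card_UN_le[OF finite_increasing_pairs])
      also have "\<dots> \<le> (\<Sum>ab\<in>?Q. X ^ d')"
        using small finD card_image_le le_trans by (intro sum_mono) blast
      also have "\<dots> \<le> card ?Q * X ^ d'"
        by simp
      finally have "card S \<le> X ^ d + card ?Q * X ^ d'"
        using small by linarith
      also have "\<dots> = (X + card ?Q) * X ^ d'"
        by (simp add: Suc algebra_simps)
      also have "\<dots> \<le> (X + card ?Q) ^ d"
        unfolding Suc power_Suc by (intro mult_le_mono2 power_mono) auto
      also have "X + card ?Q = card ?Q * card (insert i M) + 1"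
        using insert.hyps by (simp add: X_def)
      finally show False
        using insert.prems(2) by simp
    qed
    then consider "X ^ d < card S1" | ab where "ab \<in> ?Q" "X ^ d' < card (D ab)"
      by force
    then show ?thesis
    proof cases
      case 1
      have "card S1 \<le> card (?\<rho> ` S)"
        using card_image[OF inj] card_mono[of "?\<rho> ` S" "?\<rho> ` S1"] finS by (auto simp: S1_def)
      then have "(card ?Q * card M + 1) ^ d < card (?\<rho> ` S)"
        using 1 by (simp add: X_def)
      from insert.IH[OF \<rho>S this] obtain B \<pi> where B: "B \<subseteq> M" "card B = d" "\<pi> ` B \<subseteq> ?Q"
          "\<forall>Y\<subseteq>B. \<exists>h\<in>?\<rho> ` S. \<forall>i\<in>B. h i = (if i \<in> Y then snd (\<pi> i) else fst (\<pi> i))"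
        by (elim exE conjE) (rule that)
      have "\<forall>Y\<subseteq>B. \<exists>h\<in>S. \<forall>i\<in>B. h i = (if i \<in> Y then snd (\<pi> i) else fst (\<pi> i))"
      proof (intro allI impI)
        fix Y assume "Y \<subseteq> B"
        then obtain h where "h \<in> S" "\<forall>i\<in>B. ?\<rho> h i = (if i \<in> Y then snd (\<pi> i) else fst (\<pi> i))"
          using B(4) by blast
        then show "\<exists>h\<in>S. \<forall>i\<in>B. h i = (if i \<in> Y then snd (\<pi> i) else fst (\<pi> i))"
          using B(1) by (intro bexI[of _ h]) (auto simp: subset_iff)
      qed
      then show ?thesis
        using B by blast
    next
      case 2
      obtain a b where ab: "ab = (a, b)" "a < b" "b < r"
        using 2(1) by auto
      have DM: "D ab \<subseteq> M \<rightarrow>\<^sub>E {..<r}"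
        using \<rho>S by (auto simp: D_def ab(1))
      have "(card ?Q * card M + 1) ^ d' < card (D ab)"
        using 2(2) by (simp add: X_def)
      from insert.IH[OF DM this] obtain B \<pi> where B: "B \<subseteq> M" "card B = d'" "\<pi> ` B \<subseteq> ?Q"
          "\<forall>Y\<subseteq>B. \<exists>h\<in>D ab. \<forall>i\<in>B. h i = (if i \<in> Y then snd (\<pi> i) else fst (\<pi> i))"
        by (elim exE conjE) (rule that)
      have iB: "i \<notin> B"
        using B(1) insert.hyps(2) by blast
      have finB: "finite B"
        using B(1) insert.hyps(1) finite_subset by blast
      define \<pi>' where "\<pi>' = \<pi>(i := (a, b))"
      have "\<exists>h\<in>S. \<forall>j\<in>insert i B. h j = (if j \<in> Y then snd (\<pi>' j) else fst (\<pi>' j))"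
        if Y: "Y \<subseteq> insert i B" for Y
      proof -
        obtain g where g: "g \<in> D ab" "\<forall>j\<in>B. g j = (if j \<in> Y - {i} then snd (\<pi> j) else fst (\<pi> j))"
          using B(4) Y by (metis Diff_subset_conv insert_is_Un)
        show ?thesis
        proof (rule bexI[of _ "g(i := if i \<in> Y then b else a)"])
          show "\<forall>j\<in>insert i B. (g(i := if i \<in> Y then b else a)) j =
              (if j \<in> Y then snd (\<pi>' j) else fst (\<pi>' j))"
            using g(2) iB by (auto simp: \<pi>'_def)
          show "g(i := if i \<in> Y then b else a) \<in> S"
            using g(1) by (auto simp: D_def ab(1))
        qed
      qed
      moreover have "insert i B \<subseteq> insert i M" "card (insert i B) = d" "\<pi>' ` insert i B \<subseteq> ?Q"
        using B iB finB Suc ab by (auto simp: \<pi>'_def)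
      ultimately show ?thesis
        by blast
    qed
  qed
qed

section \<open>Configurations from embeddings\<close>

text \<open>
  A submatrix lists its rows in increasing order. The permutation \<open>p\<close> turns an arbitrary injective
  enumeration \<open>f\<close> of the chosen rows into that order.
\<close>

lemma permutation_to_pick:
  fixes f :: "nat \<Rightarrow> nat"
  assumes "inj_on f {..<n}"
  shows "\<exists>p. p permutes {..<n} \<and> (\<forall>i<n. f (p i) = pick (f ` {..<n}) i)"
proof -
  let ?I = "f ` {..<n}"
  have card: "card ?I = n"
    using card_image[OF assms] by simp
  define p where "p i = (if i < n then inv_into {..<n} f (pick ?I i) else i)" for i
  have pick: "pick ?I i \<in> ?I" if "i < n" for i
    using pick_in_set_le[of i ?I] that card by simp
  have fp: "f (p i) = pick ?I i" if "i < n" for i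
    using f_inv_into_f[OF pick[OF that]] that by (simp add: p_def)
  have mem: "p i < n" if "i < n" for i
    using inv_into_into[OF pick[OF that]] that by (simp add: p_def)
  have "inj_on p {..<n}"
  proof (rule inj_onI)
    fix i j assume ij: "i \<in> {..<n}" "j \<in> {..<n}" "p i = p j"
    then have "pick ?I i = pick ?I j"
      using fp by (metis lessThan_iff)
    then show "i = j"
      using ij card pick_mono_le[of i ?I j] pick_mono_le[of j ?I i]
      by (metis lessThan_iff linorder_neqE_nat less_irrefl)
  qed
  moreover have "p ` {..<n} \<subseteq> {..<n}"
    using mem by auto
  ultimately have "bij_betw p {..<n} {..<n}"
    by (simp add: bij_betw_def endo_inj_surj)
  then have "p permutes {..<n}"
    by (rule bij_imp_permutes) (simp add: p_def)
  then show ?thesis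
    using fp by blast
qed

text \<open>
  Since the columns of \<open>F\<close> are distinct, the column map \<open>\<kappa>\<close> cannot identify two of them and is
  injective as well.
\<close>

lemma configuration_if_embedding:
  fixes A F :: "'a mat"
  assumes "inj_on \<rho> {..<dim_row F}" "\<rho> ` {..<dim_row F} \<subseteq> {..<dim_row A}"
    and "\<kappa> ` {..<dim_col F} \<subseteq> {..<dim_col A}"
    and entries: "\<And>i j. i < dim_row F \<Longrightarrow> j < dim_col F \<Longrightarrow> A $$ (\<rho> i, \<kappa> j) = F $$ (i, j)"
    and distinct: "\<And>j j'. j < j' \<Longrightarrow> j' < dim_col F \<Longrightarrow> \<exists>i<dim_row F. F $$ (i, j) \<noteq> F $$ (i, j')"
  shows "F \<prec> A"
proof -
  have inj: "inj_on \<kappa> {..<dim_col F}"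
  proof (rule linorder_inj_onI')
    fix j j' assume "j \<in> {..<dim_col F}" "j' \<in> {..<dim_col F}" "j < j'"
    then show "\<kappa> j \<noteq> \<kappa> j'"
      using distinct[of j j'] entries by (metis lessThan_iff)
  qed
  obtain p where p: "p permutes {..<dim_row F}"
      "\<forall>i<dim_row F. \<rho> (p i) = pick (\<rho> ` {..<dim_row F}) i"
    using permutation_to_pick[OF assms(1)] by blast
  obtain q where q: "q permutes {..<dim_col F}"
      "\<forall>j<dim_col F. \<kappa> (q j) = pick (\<kappa> ` {..<dim_col F}) j"
    using permutation_to_pick[OF inj] by blast
  have pq: "p i < dim_row F" "q j < dim_col F" if "i < dim_row F" "j < dim_col F" for i j
    using that permutes_in_image[OF p(1)] permutes_in_image[OF q(1)] by auto
  have "{i. i < dim_row A \<and> i \<in> \<rho> ` {..<dim_row F}} = \<rho> ` {..<dim_row F}"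
      "{j. j < dim_col A \<and> j \<in> \<kappa> ` {..<dim_col F}} = \<kappa> ` {..<dim_col F}"
    using assms(2,3) by auto
  then have dims: "card {i. i < dim_row A \<and> i \<in> \<rho> ` {..<dim_row F}} = dim_row F"
      "card {j. j < dim_col A \<and> j \<in> \<kappa> ` {..<dim_col F}} = dim_col F"
    using card_image[OF assms(1)] card_image[OF inj] by simp_all
  have "permute_rows_cols p q F = submatrix A (\<rho> ` {..<dim_row F}) (\<kappa> ` {..<dim_col F})"
    unfolding permute_rows_cols_def submatrix_def dims
    using p(2) q(2) entries[OF pq] by (intro cong_mat) auto
  then show ?thesis
    unfolding configuration_def using p(1) q(1) by blast
qed

lemma I_mat_configuration:
  assumes "inj_on \<rho> {..<l}" "\<rho> ` {..<l} \<subseteq> {..<dim_row A}" "\<kappa> ` {..<l} \<subseteq> {..<dim_col A}"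
    and "\<And>i j. i < l \<Longrightarrow> j < l \<Longrightarrow> A $$ (\<rho> i, \<kappa> j) = (if i = j then a else b)" and "a \<noteq> b"
  shows "I_mat l a b \<prec> A"
proof (rule configuration_if_embedding[of \<rho> _ _ \<kappa>])
  fix j j' assume "j < j'" "j' < dim_col (I_mat l a b)"
  then show "\<exists>i<dim_row (I_mat l a b). I_mat l a b $$ (i, j) \<noteq> I_mat l a b $$ (i, j')"
    using assms(5) by (intro exI[of _ j]) (simp add: I_mat_def)
qed (use assms in \<open>auto simp: I_mat_def\<close>)

lemma T_mat_configuration:
  assumes "inj_on \<rho> {..<l}" "\<rho> ` {..<l} \<subseteq> {..<dim_row A}" "\<kappa> ` {..<l} \<subseteq> {..<dim_col A}"
    and "\<And>i j. i < l \<Longrightarrow> j < l \<Longrightarrow> A $$ (\<rho> i, \<kappa> j) = (if j < i then a else b)" and "a \<noteq> b"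
  shows "T_mat l a b \<prec> A"
proof (rule configuration_if_embedding[of \<rho> _ _ \<kappa>])
  fix j j' assume "j < j'" "j' < dim_col (T_mat l a b)"
  then show "\<exists>i<dim_row (T_mat l a b). T_mat l a b $$ (i, j) \<noteq> T_mat l a b $$ (i, j')"
    using assms(5) by (intro exI[of _ j']) (simp add: T_mat_def)
qed (use assms in \<open>auto simp: T_mat_def\<close>)

section \<open>The dichotomy\<close>

text \<open>
  The threshold is the shattering bound \<open>(q |M| + 1)\<^sup>q\<^sup>l\<close>, simplified for an \<open>M\<close> that is too small
  for \<open>many_critical_rows\<close>. The size \<open>K\<close> of the homogeneous set is left open, because two values
  need only \<open>K = l\<close> where the general case takes \<open>K = 2 l\<close>.
\<close>

lemma many_columns:
  assumes "r \<ge> 2" "r_matrix r A" "simple_matrix A"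
    and large: "(card (increasing_pairs r) * card (increasing_pairs r) * (r * r) ^ (r * r * K)) ^
      (card (increasing_pairs r) * l) < dim_col A"
  shows "(\<exists>a b. a < b \<and> b < r \<and> I_mat l b a \<prec> A) \<or>
    (\<exists>p<r. \<exists>q<r. \<exists>a b \<rho>. a < b \<and> b < r \<and> inj_on \<rho> {..<K} \<and> \<rho> ` {..<K} \<subseteq> {..<dim_row A} \<and>
    (\<forall>d\<in>{a, b}. \<exists>\<kappa>. \<kappa> ` {..<K} \<subseteq> {..<dim_col A} \<and>
      (\<forall>s<K. \<forall>t<K. A $$ (\<rho> s, \<kappa> t) = (if t < s then p else if s < t then q else d))))"
proof -
  let ?P = "increasing_pairs r"
  let ?e = "\<lambda>i j. A $$ (i, j)"
  let ?N = "(r * r) ^ (r * r * K)"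
  have q: "card ?P > 0"
    using card_increasing_pairs_pos[OF assms(1)] .
  have entry: "?e i j < r" if "i < dim_row A" "j < dim_col A" for i j
  proof -
    have "A $$ (i, j) \<in> elements_mat A"
      using that by (intro elements_matI[of A "dim_row A" "dim_col A"]) auto
    then show ?thesis
      using assms(2) by (auto simp: r_matrix_def)
  qed
  have "inj_on (\<lambda>j. restrict (\<lambda>i. ?e i j) {..<dim_row A}) {..<dim_col A}"
  proof (rule inj_onI)
    fix j j' assume j: "j \<in> {..<dim_col A}" "j' \<in> {..<dim_col A}"
      "restrict (\<lambda>i. ?e i j) {..<dim_row A} = restrict (\<lambda>i. ?e i j') {..<dim_row A}"
    then have "col A j = col A j'"
      by (intro eq_vecI) (auto simp: restrict_def fun_eq_iff split: if_splits)
    then have "cols A ! j = cols A ! j'"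
      using j by simp
    then show "j = j'"
      using assms(3) j(1,2) nth_eq_iff_index_eq[of "cols A" j j'] by (simp add: simple_matrix_def)
  qed
  then obtain M where M: "M \<subseteq> {..<dim_row A}"
      "inj_on (\<lambda>j. restrict (\<lambda>i. ?e i j) M) {..<dim_col A}"
      "\<And>i. i \<in> M \<Longrightarrow> \<exists>j\<in>{..<dim_col A}. \<exists>j'\<in>{..<dim_col A}.
        ?e i j \<noteq> ?e i j' \<and> (\<forall>i'\<in>M - {i}. ?e i' j = ?e i' j')"
    using critical_rows[of "{..<dim_row A}" ?e "{..<dim_col A}"] by auto
  have finM: "finite M"
    using M(1) finite_subset by blast
  show ?thesis
  proof (cases "card ?P * ?N \<le> card M")
    case True
    have lt: "?e i j < r" if "i \<in> M" "j \<in> {..<dim_col A}" for i j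
      using entry M(1) that by blast
    obtain p q' a b \<rho> where "p < r" "q' < r" "a < b" "b < r" "inj_on \<rho> {..<K}"
        "\<rho> ` {..<K} \<subseteq> M" "\<forall>d\<in>{a, b}. \<exists>\<kappa>. \<kappa> ` {..<K} \<subseteq> {..<dim_col A} \<and>
          (\<forall>s<K. \<forall>t<K. ?e (\<rho> s) (\<kappa> t) = (if t < s then p else if s < t then q' else d))"
    proof (rule many_critical_rows[of r M "{..<dim_col A}" ?e K])
      show "card ?P * ?N \<le> card M"
        using True .
    qed (assumption | rule assms(1) finM lt M(3))+
    moreover from this(6) M(1) have "\<rho> ` {..<K} \<subseteq> {..<dim_row A}"
      by (rule subset_trans)
    ultimately show ?thesis
      by (intro disjI2 exI[of _ p] exI[of _ q'] exI[of _ a] exI[of _ b] exI[of _ \<rho>] conjI)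
  next
    case False
    let ?S = "(\<lambda>j. restrict (\<lambda>i. ?e i j) M) ` {..<dim_col A}"
    have "card ?P * card M + 1 \<le> card ?P * (card M + 1)"
      using q by simp
    also have "\<dots> \<le> card ?P * (card ?P * ?N)"
      using False by (intro mult_le_mono2) simp
    finally have "(card ?P * card M + 1) ^ (card ?P * l) \<le> (card ?P * card ?P * ?N) ^ (card ?P * l)"
      by (intro power_mono) (simp_all add: mult.assoc)
    also have "\<dots> < card ?S"
      using large card_image[OF M(2)] by simp
    finally have card_S: "(card ?P * card M + 1) ^ (card ?P * l) < card ?S"
      .
    have "?S \<subseteq> M \<rightarrow>\<^sub>E {..<r}"
      using entry M(1) by (auto simp: PiE_iff subset_iff)
    from shattering_bound[OF finM this card_S]
    obtain B \<pi> where B: "B \<subseteq> M" "card B = card ?P * l" "\<pi> ` B \<subseteq> ?P"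
        "\<forall>X\<subseteq>B. \<exists>h\<in>?S. \<forall>i\<in>B. h i = (if i \<in> X then snd (\<pi> i) else fst (\<pi> i))"
      by (elim exE conjE) (rule that)
    have finB: "finite B"
      using B(1) finM finite_subset by blast
    obtain a b where ab: "a < b" "b < r" "l \<le> card {i \<in> B. \<pi> i = (a, b)}"
      using large_fibre[OF finB finite_increasing_pairs B(3), of l] B(2) q by auto
    obtain C where C: "C \<subseteq> {i \<in> B. \<pi> i = (a, b)}" "card C = l" "finite C"
      by (rule obtain_subset_with_card_n[OF ab(3)])
    obtain \<rho> where \<rho>: "bij_betw \<rho> {..<l} C"
      using C(2,3) ex_bij_betw_nat_finite[of C] by (auto simp: atLeast0LessThan)
    have \<rho>C: "\<rho> i \<in> C" if "i < l" for i
      using \<rho> that by (auto simp: bij_betw_def)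
    \<comment> \<open>Shattering applied to singletons gives columns that single out one row each.\<close>
    have "\<exists>c<dim_col A. \<forall>i\<in>B. ?e i c = (if i = \<rho> j then snd (\<pi> i) else fst (\<pi> i))" if "j < l" for j
    proof -
      have "{\<rho> j} \<subseteq> B"
        using \<rho>C[OF that] C(1) by blast
      with B(4) have "\<exists>h\<in>?S. \<forall>i\<in>B. h i = (if i \<in> {\<rho> j} then snd (\<pi> i) else fst (\<pi> i))"
        by (elim allE impE)
      then obtain c where "c < dim_col A"
          "\<forall>i\<in>B. restrict (\<lambda>i. ?e i c) M i = (if i \<in> {\<rho> j} then snd (\<pi> i) else fst (\<pi> i))"
        by (elim bexE imageE) auto
      then show ?thesis
        using B(1) by (intro exI[of _ c]) (auto simp: subset_iff)
    qed
    then obtain \<kappa> where \<kappa>: "\<And>j. j < l \<Longrightarrow> \<kappa> j < dim_col A"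
        "\<And>i j. j < l \<Longrightarrow> i \<in> B \<Longrightarrow> ?e i (\<kappa> j) = (if i = \<rho> j then snd (\<pi> i) else fst (\<pi> i))"
      by metis
    have "I_mat l b a \<prec> A"
    proof (rule I_mat_configuration[of \<rho> _ _ \<kappa>])
      show inj: "inj_on \<rho> {..<l}"
        using \<rho> by (simp add: bij_betw_def)
      show "\<rho> ` {..<l} \<subseteq> {..<dim_row A}" "\<kappa> ` {..<l} \<subseteq> {..<dim_col A}"
        using \<rho>C C(1) B(1) M(1) \<kappa>(1) by blast+
      fix i j assume ij: "i < l" "j < l"
      have "\<rho> i \<in> B" "\<pi> (\<rho> i) = (a, b)"
        using \<rho>C[OF ij(1)] C(1) by auto
      moreover have "\<rho> i = \<rho> j \<longleftrightarrow> i = j"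
        using inj ij by (auto simp: inj_on_def)
      ultimately show "A $$ (\<rho> i, \<kappa> j) = (if i = j then b else a)"
        using \<kappa>(2)[OF ij(2)] by auto
    qed (use ab in simp)
    then show ?thesis
      using ab by blast
  qed
qed

section \<open>Bounds on the number of columns\<close>

lemma forb_le:
  assumes "\<And>F. F \<in> \<F> \<Longrightarrow> dim_col F > 0"
    and "\<And>A. A \<in> avoiding m r \<F> \<Longrightarrow> dim_col A \<le> N"
  shows "forb m r \<F> \<le> N"
  unfolding forb_def
  using finite_avoiding[of m r \<F>] avoiding_nonempty[OF assms(1)] assms(2) by (subst Max_le_iff) auto

lemma T_family_intros:
  assumes "a < r" "b < r" "a \<noteq> b"
  shows "I_mat l a b \<in> T_family l r" "T_mat l a b \<in> T_family l r"
  unfolding T_family_def using assms by blast+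

lemma dim_col_avoiding_T_family:
  assumes "r \<ge> 2" "A \<in> avoiding m r (T_family l r)"
  shows "dim_col A \<le> (r ^ 4 * (r * r) ^ (r * r * (2 * l))) ^ (r * r * l)"
proof (rule ccontr)
  assume big: "\<not> ?thesis"
  let ?P = "increasing_pairs r"
  let ?N = "(r * r) ^ (r * r * (2 * l))"
  have A: "r_matrix r A" "simple_matrix A"
    using assms(2) by (auto simp: avoiding_def)
  have noI: "\<not> I_mat l a b \<prec> A" if "a < r" "b < r" "a \<noteq> b" for a b
    using assms(2) T_family_intros[OF that] by (auto simp: avoiding_def)
  have noT: "\<not> T_mat l a b \<prec> A" if "a < r" "b < r" "a \<noteq> b" for a b
    using assms(2) T_family_intros[OF that] by (auto simp: avoiding_def)
  have "card ?P \<le> card ({..<r} \<times> {..<r})"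
    by (intro card_mono) auto
  then have q: "card ?P \<le> r * r"
    by simp
  have "(card ?P * card ?P * ?N) ^ (card ?P * l) \<le> (r ^ 4 * ?N) ^ (card ?P * l)"
    using mult_le_mono[OF q q] by (intro power_mono mult_le_mono1) (simp_all add: power4_eq_xxxx mult.assoc)
  also have "\<dots> \<le> (r ^ 4 * ?N) ^ (r * r * l)"
    using q assms(1) by (intro power_increasing mult_le_mono1) (simp_all add: Suc_leI)
  also have "\<dots> < dim_col A"
    using big by simp
  finally have "(card ?P * card ?P * ?N) ^ (card ?P * l) < dim_col A" .
  from many_columns[OF assms(1) A this] show False
  proof (elim disjE exE conjE)
    fix a b assume "a < b" "b < r" "I_mat l b a \<prec> A"
    then show False using noI[of b a] by simp
  next
    fix p q a b \<rho>
    assume pq: "p < r" "q < r" and ab: "a < b" "b < r"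
      and \<rho>: "inj_on \<rho> {..<2 * l}" "\<rho> ` {..<2 * l} \<subseteq> {..<dim_row A}"
      and \<kappa>: "\<forall>d\<in>{a, b}. \<exists>\<kappa>. \<kappa> ` {..<2 * l} \<subseteq> {..<dim_col A} \<and> (\<forall>s<2 * l. \<forall>t<2 * l.
        A $$ (\<rho> s, \<kappa> t) = (if t < s then p else if s < t then q else d))"
    show False
    proof (cases "p = q")
      case True
      obtain d where d: "d \<in> {a, b}" "d \<noteq> p"
        using ab(1) by (cases "a = p") auto
      then obtain \<kappa> where "\<kappa> ` {..<2 * l} \<subseteq> {..<dim_col A}" "\<forall>s<2 * l. \<forall>t<2 * l.
          A $$ (\<rho> s, \<kappa> t) = (if t < s then p else if s < t then q else d)"
        using \<kappa> by blast
      then have "I_mat l d p \<prec> A"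
        by (intro I_mat_configuration[of \<rho> _ _ \<kappa>])
          (use \<rho> True d(2) in \<open>auto intro: inj_on_subset simp: image_subset_iff\<close>)
      then show False
        using noI[of d p] d ab pq by auto
    next
      case False
      obtain \<kappa> where \<kappa>: "\<kappa> ` {..<2 * l} \<subseteq> {..<dim_col A}" "\<forall>s<2 * l. \<forall>t<2 * l.
          A $$ (\<rho> s, \<kappa> t) = (if t < s then p else if s < t then q else a)"
        using \<kappa> by blast
      \<comment> \<open>The third value \<open>a\<close> may occur on the diagonal, which even rows and odd columns do not meet.\<close>
      have "T_mat l p q \<prec> A"
      proof (rule T_mat_configuration[of "\<lambda>i. \<rho> (2 * i)" _ _ "\<lambda>j. \<kappa> (2 * j + 1)"])
        show "inj_on (\<lambda>i. \<rho> (2 * i)) {..<l}"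
        proof (rule inj_onI)
          fix i j assume ij: "i \<in> {..<l}" "j \<in> {..<l}" "\<rho> (2 * i) = \<rho> (2 * j)"
          then show "i = j"
            using inj_onD[OF \<rho>(1) ij(3)] by simp
        qed
        show "(\<lambda>i. \<rho> (2 * i)) ` {..<l} \<subseteq> {..<dim_row A}"
          using \<rho>(2) by (auto simp: image_subset_iff)
        show "(\<lambda>j. \<kappa> (2 * j + 1)) ` {..<l} \<subseteq> {..<dim_col A}"
          using \<kappa>(1) by (auto simp: image_subset_iff)
        fix i j assume "i < l" "j < l"
        then show "A $$ (\<rho> (2 * i), \<kappa> (2 * j + 1)) = (if j < i then p else q)"
          using \<kappa>(2)[rule_format, of "2 * i" "2 * j + 1"] by (auto split: if_splits)
      qed (rule False)
      then show False
        using noT[of p q] False pq by blast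
    qed
  qed
qed

lemma binary_family_eq:
  "1\<^sub>m l = I_mat l 1 0" "complement01 (1\<^sub>m l) = I_mat l 0 1" "upper_T l = T_mat l 0 1"
  by (auto simp: I_mat_def T_mat_def upper_T_def complement01_def one_mat_def intro!: eq_matI)

text \<open>
  Both diagonal values \<open>0\<close> and \<open>1\<close> are available on any homogeneous set, so the diagonal can be
  made to fit the pattern in each of the four cases for \<open>(p, q)\<close>. In the two triangular cases it
  is set to \<open>1\<close>, as in \<open>T\<^sub>l\<close>.
\<close>

lemma dim_col_avoiding_binary:
  assumes "A \<in> avoiding m 2 {1\<^sub>m l, complement01 (1\<^sub>m l), upper_T l}"
  shows "dim_col A \<le> 2 ^ (8 * l\<^sup>2)"
proof (rule ccontr)
  assume big: "\<not> ?thesis"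
  have A: "r_matrix 2 A" "simple_matrix A"
    using assms(1) by (auto simp: avoiding_def)
  have no: "\<not> I_mat l 1 0 \<prec> A" "\<not> I_mat l 0 1 \<prec> A" "\<not> T_mat l 0 1 \<prec> A"
    unfolding binary_family_eq[symmetric] using assms by (auto simp: avoiding_def)
  have pair: "a = 0 \<and> b = 1" if "a < b" "b < 2" for a b :: nat
    using that by auto
  have "increasing_pairs 2 = {(0, 1)}"
    using pair by auto
  then have q: "card (increasing_pairs 2) = 1"
    by simp
  have "(2 * 2 :: nat) ^ (2 * 2 * l) = (2 ^ 2) ^ (4 * l)"
    by simp
  also have "\<dots> = 2 ^ (8 * l)"
    by (simp only: power_mult[symmetric] mult.assoc[symmetric]) simp
  finally have "((2 * 2 :: nat) ^ (2 * 2 * l)) ^ l = 2 ^ (8 * l\<^sup>2)"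
    by (simp add: power_mult[symmetric] power2_eq_square mult.assoc)
  then have "(card (increasing_pairs 2) * card (increasing_pairs 2) *
      (2 * 2) ^ (2 * 2 * l)) ^ (card (increasing_pairs 2) * l) < dim_col A"
    using big unfolding q by simp
  from many_columns[OF order_refl A this] show False
  proof (elim disjE exE conjE)
    fix a b :: nat assume "a < b" "b < 2" "I_mat l b a \<prec> A"
    then show False using no(1) pair by blast
  next
    fix p q a b :: nat and \<rho>
    assume pq: "p < 2" "q < 2" and ab: "a < b" "b < 2"
      and \<rho>: "inj_on \<rho> {..<l}" "\<rho> ` {..<l} \<subseteq> {..<dim_row A}"
      and \<kappa>: "\<forall>d\<in>{a, b}. \<exists>\<kappa>. \<kappa> ` {..<l} \<subseteq> {..<dim_col A} \<and> (\<forall>s<l. \<forall>t<l.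
        A $$ (\<rho> s, \<kappa> t) = (if t < s then p else if s < t then q else d))"
    have diag: "\<exists>\<kappa>. \<kappa> ` {..<l} \<subseteq> {..<dim_col A} \<and> (\<forall>s<l. \<forall>t<l.
        A $$ (\<rho> s, \<kappa> t) = (if t < s then p else if s < t then q else d))" if "d \<in> {0, 1}" for d
      using \<kappa> that pair[OF ab] by blast
    obtain \<kappa>0 where \<kappa>0: "\<kappa>0 ` {..<l} \<subseteq> {..<dim_col A}" "\<forall>s<l. \<forall>t<l.
        A $$ (\<rho> s, \<kappa>0 t) = (if t < s then p else if s < t then q else 0)"
      using diag by blast
    obtain \<kappa>1 where \<kappa>1: "\<kappa>1 ` {..<l} \<subseteq> {..<dim_col A}" "\<forall>s<l. \<forall>t<l.
        A $$ (\<rho> s, \<kappa>1 t) = (if t < s then p else if s < t then q else 1)"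
      using diag by blast
    consider "p = 0 \<and> q = 0" | "p = 1 \<and> q = 1" | "p = 0 \<and> q = 1" | "p = 1 \<and> q = 0"
      using pq by (auto simp: less_2_cases_iff)
    then show False
    proof cases
      case 1
      then have "I_mat l 1 0 \<prec> A"
        using \<rho> \<kappa>1 by (intro I_mat_configuration[of \<rho> _ _ \<kappa>1]) auto
      then show False using no by blast
    next
      case 2
      then have "I_mat l 0 1 \<prec> A"
        using \<rho> \<kappa>0 by (intro I_mat_configuration[of \<rho> _ _ \<kappa>0]) auto
      then show False using no by blast
    next
      case 3
      then have "T_mat l 0 1 \<prec> A"
        using \<rho> \<kappa>1 by (intro T_mat_configuration[of \<rho> _ _ \<kappa>1]) auto
      then show False using no by blast
    next
      case 4
      \<comment> \<open>Reversing the order of rows and of columns exchanges the two triangles.\<close>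
      have "T_mat l 0 1 \<prec> A"
      proof (rule T_mat_configuration[of "\<lambda>i. \<rho> (l - 1 - i)" _ _ "\<lambda>j. \<kappa>1 (l - 1 - j)"])
        show "inj_on (\<lambda>i. \<rho> (l - 1 - i)) {..<l}"
        proof (rule inj_onI)
          fix i j assume ij: "i \<in> {..<l}" "j \<in> {..<l}" "\<rho> (l - 1 - i) = \<rho> (l - 1 - j)"
          then have "l - 1 - i = l - 1 - j"
            using inj_onD[OF \<rho>(1) ij(3)] by simp
          then show "i = j"
            using ij by simp
        qed
        show "(\<lambda>i. \<rho> (l - 1 - i)) ` {..<l} \<subseteq> {..<dim_row A}"
          using \<rho>(2) by (auto simp: image_subset_iff)
        show "(\<lambda>j. \<kappa>1 (l - 1 - j)) ` {..<l} \<subseteq> {..<dim_col A}"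
          using \<kappa>1(1) by (auto simp: image_subset_iff)
        fix i j assume "i < l" "j < l"
        then show "A $$ (\<rho> (l - 1 - i), \<kappa>1 (l - 1 - j)) = (if j < i then 0 else 1)"
          using \<kappa>1(2)[rule_format, of "l - 1 - i" "l - 1 - j"] 4 by auto
      qed simp
      then show False using no by blast
    qed
  qed
qed

lemma avoiding_antimono:
  assumes "\<F> \<subseteq> \<G>"
  shows "avoiding m r \<G> \<subseteq> avoiding m r \<F>"
  using assms by (auto simp: avoiding_def)

text \<open>Since \<open>15.51 / 6 = 517 / 200\<close>, the claim is the integer inequality
  \<open>6\<^sup>2\<^sup>0\<^sup>0 < 2\<^sup>5\<^sup>1\<^sup>7\<close>.\<close>

lemma six_log_2_6_less: "6 * log 2 6 < (15.51 :: real)"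
proof -
  have "200 * log 2 6 = log 2 (6 ^ 200)"
    by (subst log_nat_power) auto
  also have "\<dots> < log 2 (2 ^ 517)"
    by (subst log_less_cancel_iff) auto
  also have "\<dots> = 517"
    by (subst log_nat_power) auto
  finally show ?thesis by simp
qed

theorem theorem1p2:
  shows "\<exists>c :: nat \<Rightarrow> real.
    (\<forall>r\<ge>2. \<forall>l\<ge>1. \<forall>m\<ge>1.
       real (forb m r (T_family l r)) \<le> 2 powr (c r * real l ^ 2)) \<and>
    (\<forall>l\<ge>1. \<forall>m\<ge>1.
       real (forb m 2 {1\<^sub>m l, complement01 (1\<^sub>m l), upper_T l})
         \<le> 2 powr (c 2 * (real l ^ 2 + real l))) \<and>
    c 2 \<le> 6 * log 2 6 \<and> 6 * log 2 6 < (15.51 :: real)"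
proof -
  \<comment> \<open>For \<open>r > 2\<close> the bound on the columns is a power of \<open>r\<close> with exponent
    \<open>(4 + 4 r\<^sup>2 l) r\<^sup>2 l\<close>, and \<open>4 \<le> 4 l\<close>.\<close>
  define c :: "nat \<Rightarrow> real" where
    "c r = (if r = 2 then 8 else log 2 r * (real (r * r) * (4 + 4 * real (r * r))))" for r
  have dim_T: "dim_col F > 0" if "l \<ge> 1" "F \<in> T_family l r" for F l r
    using that by (auto simp: T_family_def I_mat_def T_mat_def)
  have sub: "{1\<^sub>m l, complement01 (1\<^sub>m l), upper_T l} \<subseteq> T_family l 2" for l
    unfolding binary_family_eq(2) unfolding binary_family_eq(1,3) by (simp add: T_family_intros)
  have bin: "real n \<le> 2 powr (8 * real l ^ 2)" if "n \<le> 2 ^ (8 * l\<^sup>2)" for n l :: nat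
  proof -
    have "real n \<le> 2 ^ (8 * l\<^sup>2)"
      using that by (metis of_nat_le_iff of_nat_numeral of_nat_power)
    also have "\<dots> = 2 powr (8 * real l ^ 2)"
      by (simp add: powr_realpow[symmetric])
    finally show ?thesis .
  qed
  have "real (forb m r (T_family l r)) \<le> 2 powr (c r * real l ^ 2)" if "r \<ge> 2" "l \<ge> 1" for r l m
  proof (cases "r = 2")
    case True
    have "forb m 2 (T_family l 2) \<le> 2 ^ (8 * l\<^sup>2)"
      using dim_T[OF that(2)] dim_col_avoiding_binary avoiding_antimono[OF sub]
      by (intro forb_le) blast+
    then show ?thesis
      using bin True by (simp add: c_def)
  next
    case False
    let ?s = "r * r"
    let ?E = "(4 + 4 * ?s * l) * (?s * l)"
    have "forb m r (T_family l r) \<le> (r ^ 4 * ?s ^ (?s * (2 * l))) ^ (?s * l)"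
      using dim_T[OF that(2)] dim_col_avoiding_T_family[OF that(1)] by (intro forb_le) blast+
    also have "?s ^ (?s * (2 * l)) = (r ^ 2) ^ (?s * (2 * l))"
      by (simp add: power2_eq_square)
    also have "\<dots> = r ^ (4 * ?s * l)"
      by (simp only: power_mult[symmetric]) (simp add: algebra_simps)
    also have "(r ^ 4 * r ^ (4 * ?s * l)) ^ (?s * l) = r ^ ?E"
      by (simp only: power_add[symmetric] power_mult[symmetric])
    finally have "real (forb m r (T_family l r)) \<le> real (r ^ ?E)"
      by (rule of_nat_mono)
    also have "\<dots> = real r powr real ?E"
      using that(1) by (simp add: powr_realpow[symmetric] del: of_nat_mult of_nat_add)
    also have "\<dots> = 2 powr (log 2 r * real ?E)"
      using that(1) by (simp add: powr_powr[symmetric] del: of_nat_mult of_nat_add)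
    also have "\<dots> \<le> 2 powr (c r * real l ^ 2)"
    proof -
      have "?E \<le> (4 * l + 4 * ?s * l) * (?s * l)"
        using that(2) by (intro mult_le_mono1 add_le_mono) auto
      also have "\<dots> = ?s * (4 + 4 * ?s) * l\<^sup>2"
        by (simp add: algebra_simps power2_eq_square)
      finally have "real ?E \<le> real (?s * (4 + 4 * ?s) * l\<^sup>2)"
        by (rule of_nat_mono)
      then have "log 2 r * real ?E \<le> log 2 r * real (?s * (4 + 4 * ?s) * l\<^sup>2)"
        using that(1) by (intro mult_left_mono) auto
      also have "\<dots> = c r * real l ^ 2"
        using False by (simp add: c_def)
      finally show ?thesis by simp
    qed
    finally show ?thesis .
  qed
  moreover have "real (forb m 2 {1\<^sub>m l, complement01 (1\<^sub>m l), upper_T l})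
      \<le> 2 powr (c 2 * (real l ^ 2 + real l))" if "l \<ge> 1" for l m
  proof -
    have "forb m 2 {1\<^sub>m l, complement01 (1\<^sub>m l), upper_T l} \<le> 2 ^ (8 * l\<^sup>2)"
      using dim_T[OF that] sub[of l] dim_col_avoiding_binary by (intro forb_le) blast+
    then have "real (forb m 2 {1\<^sub>m l, complement01 (1\<^sub>m l), upper_T l}) \<le> 2 powr (8 * real l ^ 2)"
      by (rule bin)
    also have "\<dots> \<le> 2 powr (c 2 * (real l ^ 2 + real l))"
      by (simp add: c_def)
    finally show ?thesis .
  qed
  moreover have "c 2 \<le> 6 * log 2 6"
  proof -
    have "log 2 4 \<le> log 2 (6 :: real)"
      by (subst log_le_cancel_iff) auto
    moreover have "log 2 (4 :: real) = 2"
      using log_nat_power[of 2 2 2] by simp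
    moreover have "8 \<le> 6 * (2 :: real)"
      by simp
    ultimately have "8 \<le> 6 * log 2 (6 :: real)"
      by linarith
    then show ?thesis
      by (simp add: c_def)
  qed
  ultimately show ?thesis
    using six_log_2_6_less by blast
qed

end
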